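(* Let $p>q>0$ be integers. Then the following relations hold: a) $E(p,q)=E(p,p-q)$; b) $E(p,q)=E(p,r)$ whenever $r$ is an integer with $0<r<p$ and $rq\equiv1 \pmod p$ (in this case $p$ and $q$ are coprime).
   Context: For nonnegative integers $p,q$, not both zero, $E(p,q)$ is the number of subtractions (smaller number from larger) that the subtractive Euclid algorithm needs to convert the unordered pair $(p,q)$ into $(d,0)$, $d=\gcd(p,q)$. Equivalently, for $p,q>0$ it is the sum of the elements (partial quotients) of the continued fraction of $p/q$. *)

theory Defs
  imports Complex_Main "HOL-Number_Theory.Cong"
begin

text \<open>
  The two components represent an unordered pair. If they are equal, either one may be
  subtracted from the other; the step turns \<open>(d, d)\<close> into \<open>(0, d)\<close>.
\<close>

fun subtract_step :: "nat \<times> nat \<Rightarrow> nat \<times> nat" where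
  "subtract_step (p, q) = (if q \<le> p then (p - q, q) else (p, q - p))"

function euclid_E :: "nat \<Rightarrow> nat \<Rightarrow> nat" where
  "euclid_E p q =
     (if p = 0 \<or> q = 0 then 0
      else if q \<le> p then Suc (euclid_E (p - q) q)
      else Suc (euclid_E p (q - p)))"
  by auto
termination by (relation "measure (\<lambda>(p, q). p + q)") auto

declare euclid_E.simps [simp del]

text \<open>
  The recursion counts the subtractions needed to reach \<open>{gcd p q, 0}\<close>.
\<close>

lemma euclid_E_eq_Least:
  assumes "p \<noteq> 0 \<or> q \<noteq> 0"
  shows "euclid_E p q =
    (LEAST n. (subtract_step ^^ n) (p, q) \<in> {(gcd p q, 0), (0, gcd p q)})"
  using assms
proof (induction p q rule: euclid_E.induct)
  case (1 p q)
  let ?P = "\<lambda>p q n. (subtract_step ^^ n) (p, q) \<in> {(gcd p q, 0), (0, gcd p q)}"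
  have reach: "\<exists>n. ?P p q n" if "p \<noteq> 0 \<or> q \<noteq> 0" for p q :: nat
    using that
  proof (induction p q rule: euclid_E.induct)
    case (1 p q)
    show ?case
    proof (cases "p = 0 \<or> q = 0")
      case True
      then show ?thesis by (intro exI[of _ 0]) auto
    next
      case False
      show ?thesis
      proof (cases "q \<le> p")
        case True
        obtain n where "?P (p - q) q n" using "1.IH"(1)[OF False True] False by metis
        then have "?P p q (Suc n)"
          using True by (simp add: funpow_Suc_right gcd_diff1_nat del: funpow.simps)
        then show ?thesis by blast
      next
        case le: False
        obtain n where "?P p (q - p) n" using "1.IH"(2)[OF False le] False by metis
        moreover have "gcd p (q - p) = gcd p q"
          using le by (metis gcd.commute gcd_diff1_nat nat_le_linear)
        ultimately have "?P p q (Suc n)"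
          using le by (simp add: funpow_Suc_right del: funpow.simps)
        then show ?thesis by blast
      qed
    qed
  qed
  show ?case
  proof (cases "p = 0 \<or> q = 0")
    case True
    then have "?P p q 0" by auto
    then have "(LEAST n. ?P p q n) = 0" by (simp add: Least_eq_0)
    then show ?thesis using True by (simp add: euclid_E.simps)
  next
    case False
    obtain m where m: "?P p q m" using reach "1.prems" by blast
    have not0: "\<not> ?P p q 0" using False by auto
    have L: "(LEAST n. ?P p q n) = Suc (LEAST n. ?P p q (Suc n))"
      using Least_Suc[of "?P p q", OF m not0] .
    show ?thesis
    proof (cases "q \<le> p")
      case True
      have "?P p q (Suc n) = ?P (p - q) q n" for n
        using True by (simp add: funpow_Suc_right gcd_diff1_nat del: funpow.simps)
      then show ?thesis
        using L "1.IH"(1) False True by (simp add: euclid_E.simps[of p q])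
    next
      case le: False
      have "gcd p (q - p) = gcd p q"
        using le by (metis gcd.commute gcd_diff1_nat nat_le_linear)
      then have "?P p q (Suc n) = ?P p (q - p) n" for n
        using le by (simp add: funpow_Suc_right del: funpow.simps)
      then show ?thesis
        using L "1.IH"(2) False le by (simp add: euclid_E.simps[of p q])
    qed
  qed
qed

end

theory Submission
  imports Defs
begin

text \<open>
  A nonnegative integer matrix \<open>M\<close> of determinant 1 is a product of \<open>n\<close> elementary matrices,
  and \<open>M\<close> then adds exactly \<open>n\<close> subtractions to the Euclid algorithm on any positive vector. The
  transpose has the same number of factors, so the row sums and the column sums of \<open>M\<close> need equally
  many subtractions. If \<open>r * q = 1 + k * p\<close>, the matrix with rows \<open>(r - k, p - q - r + k)\<close>
  and \<open>(k, q - k)\<close> has determinant 1, row sums \<open>(p - q, q)\<close> and column sums \<open>(r, p - r)\<close>.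
\<close>

lemma euclid_E_commute: "euclid_E p q = euclid_E q p"
proof (induction p q rule: euclid_E.induct)
  case (1 p q)
  show ?case
  proof (cases "p = 0 \<or> q = 0")
    case True
    then show ?thesis by (subst (1 2) euclid_E.simps) auto
  next
    case False
    then show ?thesis
      using 1 by (subst (1 2) euclid_E.simps) (cases p q rule: linorder_cases; simp)
  qed
qed

lemma euclid_E_add_left:
  assumes "0 < q"
  shows "euclid_E (p + q) q = Suc (euclid_E p q)"
  using assms by (subst euclid_E.simps) simp

lemma euclid_E_add_right:
  assumes "0 < p"
  shows "euclid_E p (q + p) = Suc (euclid_E p q)"
  using euclid_E_add_left[OF assms] by (simp add: euclid_E_commute)

text \<open>Induction on the entry sum: subtracting the smaller row from the larger strips one
  elementary factor. Both conjuncts share \<open>n\<close>, which ties the matrix to its transpose.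
  All positive \<open>x\<close>, \<open>y\<close> are needed because in the transpose the stripped
  factor acts on the vector.\<close>

lemma euclid_E_unimodular:
  fixes a b c d :: nat
  assumes "a * d = b * c + 1"
  shows "\<exists>n. \<forall>x y. 0 < x \<longrightarrow> 0 < y \<longrightarrow>
    euclid_E (a * x + b * y) (c * x + d * y) = n + euclid_E x y \<and>
    euclid_E (a * x + c * y) (b * x + d * y) = n + euclid_E x y"
  using assms
proof (induction "a + b + c + d" arbitrary: a b c d rule: less_induct)
  case less
  have pos: "0 < a" "0 < d" using less.prems by (auto intro: Nat.gr0I)
  consider "c \<le> a" "d \<le> b" | "a \<le> c" "b \<le> d" | "a < c" "d < b" | "c < a" "b < d"
    by linarith
  then show ?case
  proof cases
    case 1
    obtain a' b' where eq: "a = a' + c" "b = b' + d"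
      using 1 le_Suc_ex by (metis add.commute)
    have "a' * d = b' * c + 1" using less.prems by (simp add: eq algebra_simps)
    then obtain n where n: "\<And>x y. 0 < x \<Longrightarrow> 0 < y \<Longrightarrow>
        euclid_E (a' * x + b' * y) (c * x + d * y) = n + euclid_E x y \<and>
        euclid_E (a' * x + c * y) (b' * x + d * y) = n + euclid_E x y"
      using less.hyps[of a' b' c d] pos by (auto simp: eq)
    show ?thesis
    proof (intro exI[of _ "Suc n"] allI impI conjI)
      fix x y :: nat assume xy: "0 < x" "0 < y"
      have "a * x + b * y = (a' * x + b' * y) + (c * x + d * y)"
        by (simp add: eq algebra_simps)
      then show "euclid_E (a * x + b * y) (c * x + d * y) = Suc n + euclid_E x y"
        using n[OF xy] xy pos by (simp add: euclid_E_add_left)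
      \<comment> \<open>Here the factor acts first, so the induction hypothesis is applied at
        \<open>(x, y + x)\<close> and the extra subtraction is the one taking this pair to
        \<open>(x, y)\<close>.\<close>
      have "a * x + c * y = a' * x + c * (y + x)" "b * x + d * y = b' * x + d * (y + x)"
        by (simp_all add: eq algebra_simps)
      then show "euclid_E (a * x + c * y) (b * x + d * y) = Suc n + euclid_E x y"
        using n[of x "y + x"] xy by (simp add: euclid_E_add_right)
    qed
  next
    case 2
    obtain c' d' where eq: "c = c' + a" "d = d' + b"
      using 2 le_Suc_ex by (metis add.commute)
    have "a * d' = b * c' + 1" using less.prems by (simp add: eq algebra_simps)
    then obtain n where n: "\<And>x y. 0 < x \<Longrightarrow> 0 < y \<Longrightarrow>
        euclid_E (a * x + b * y) (c' * x + d' * y) = n + euclid_E x y \<and>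
        euclid_E (a * x + c' * y) (b * x + d' * y) = n + euclid_E x y"
      using less.hyps[of a b c' d'] pos by (auto simp: eq)
    show ?thesis
    proof (intro exI[of _ "Suc n"] allI impI conjI)
      fix x y :: nat assume xy: "0 < x" "0 < y"
      have "c * x + d * y = (c' * x + d' * y) + (a * x + b * y)"
        by (simp add: eq algebra_simps)
      then show "euclid_E (a * x + b * y) (c * x + d * y) = Suc n + euclid_E x y"
        using n[OF xy] xy pos by (simp add: euclid_E_add_right)
      have "a * x + c * y = a * (x + y) + c' * y" "b * x + d * y = b * (x + y) + d' * y"
        by (simp_all add: eq algebra_simps)
      then show "euclid_E (a * x + c * y) (b * x + d * y) = Suc n + euclid_E x y"
        using n[of "x + y" y] xy by (simp add: euclid_E_add_left)
    qed
  next
    \<comment> \<open>The determinant would be at most 0.\<close>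
    case 3
    then have "a * d \<le> c * b" by (intro mult_mono) auto
    with less.prems show ?thesis by (simp add: mult.commute)
  next
    \<comment> \<open>Now \<open>(c + 1) * (b + 1)\<close> is at most \<open>b * c + 1\<close>,
      which leaves only the identity matrix.\<close>
    case 4
    then have "Suc c * Suc b \<le> a * d" by (intro mult_mono) auto
    then have "b = 0" "c = 0" using less.prems by (auto simp: algebra_simps)
    with less.prems show ?thesis by (intro exI[of _ 0]) auto
  qed
qed

lemma euclid_E_row_column_sums:
  fixes a b c d :: nat
  assumes "a * d = b * c + 1"
  shows "euclid_E (a + b) (c + d) = euclid_E (a + c) (b + d)"
  using euclid_E_unimodular[OF assms] by (metis less_one mult.right_neutral)

lemma euclid_E_diff:
  assumes "q < p" "0 < q"
  shows "euclid_E p q = Suc (euclid_E (p - q) q)"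
  using assms euclid_E_add_left[of q "p - q"] by simp

text \<open>One subtraction takes both pairs to the same unordered pair, \<open>p - q\<close> and
  \<open>q\<close>.\<close>

lemma euclid_E_reflect:
  assumes "q < p" "0 < q"
  shows "euclid_E p q = euclid_E p (p - q)"
  using assms euclid_E_diff[of q p] euclid_E_diff[of "p - q" p] euclid_E_commute[of q "p - q"]
  by simp

lemma euclid_E_inverse:
  fixes p q r k :: nat
  assumes "0 < q" "q < p" "0 < r" "r < p" and eq: "r * q = 1 + k * p"
  shows "euclid_E p q = euclid_E p r"
proof -
  have "k < r"
  proof (rule ccontr)
    assume "\<not> k < r"
    then have "r * q < k * p" using assms by (intro mult_le_less_imp_less) auto
    then show False using eq by simp
  qed
  moreover have "k < q"
  proof (rule ccontr)
    assume "\<not> k < q"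
    then have "q * r < k * p" using assms by (intro mult_le_less_imp_less) auto
    then show False using eq by (simp add: mult.commute)
  qed
  \<comment> \<open>This makes the upper right matrix entry nonnegative. It follows from
    \<open>(p - q) * (p - r) > 0\<close>, since this product is 1 more than a multiple of
    \<open>p\<close>.\<close>
  moreover have "q + r \<le> p + k"
  proof -
    have "0 < (int p - int q) * (int p - int r)" using assms by simp
    also have "\<dots> = int p * (int p + int k - int q - int r) + 1"
      using arg_cong[OF eq, of int] by (simp add: algebra_simps)
    finally have "0 \<le> int p * (int p + int k - int q - int r)" by simp
    then show ?thesis using assms by (simp add: zero_le_mult_iff)
  qed
  \<comment> \<open>The matrix entries are \<open>a = r - k\<close>,
    \<open>b = p + k - q - r\<close>, \<open>d = q - k\<close>, with \<open>k\<close> at the lower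
    left.\<close>
  ultimately obtain a b d where abd: "r = a + k" "q = d + k" "p = a + b + k + d"
  proof -
    assume "k < r" "k < q" "q + r \<le> p + k"
    then have "r = (r - k) + k" "q = (q - k) + k"
      "p = (r - k) + (p + k - q - r) + k + (q - k)" by linarith+
    then show thesis by (rule that)
  qed
  have "a * d = b * k + 1" using eq by (simp add: abd algebra_simps)
  then have "euclid_E (p - q) q = euclid_E r (p - r)"
    using euclid_E_row_column_sums[of a d b k] by (simp add: abd add.commute add.left_commute)
  then show ?thesis
    using assms euclid_E_diff[of q p] euclid_E_diff[of r p] euclid_E_commute[of r "p - r"] by simp
qed

theorem theorem1:
  fixes p q :: nat
  assumes "0 < q" and "q < p"
  shows "euclid_E p q = euclid_E p (p - q) \<and>
    (\<forall>r::nat. 0 < r \<longrightarrow> r < p \<longrightarrow> [r * q = 1] (mod p) \<longrightarrow>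
       coprime p q \<and> euclid_E p q = euclid_E p r)"
proof (intro conjI allI impI)
  show "euclid_E p q = euclid_E p (p - q)" using assms by (intro euclid_E_reflect)
next
  fix r :: nat
  assume r: "0 < r" "r < p" "[r * q = 1] (mod p)"
  have "[q * r = Suc 0] (mod p)" using r(3) by (simp add: mult.commute)
  then show "coprime p q" using coprime_iff_invertible_nat by (metis coprime_commute)
  \<comment> \<open>This bound lets the congruence yield a natural number quotient
    \<open>k\<close>.\<close>
  have "1 \<le> r * q" using r assms by (simp add: Suc_leI)
  then obtain k where "r * q = 1 + k * p"
    using r(3) by (metis cong_le_nat add.commute)
  then show "euclid_E p q = euclid_E p r" using euclid_E_inverse assms r by blast
qed

end
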